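(* Let $m\in\mathbb{N}$, let $S\subseteq(0,\infty)$ be a dense subsemigroup of $([0,\infty),+)$ and let $A\subseteq S^m$. The following are equivalent: (1) There is an idempotent $p\in 0_S^*$ such that $A\in\otimes_{i=1}^m p$. (2) There is a sequence $\langle x_n\rangle_{n=1}^\infty$ in $S$ such that $\sum_{n=1}^\infty x_n$ converges and $\{(\sum_{n\in F_1}x_n,\sum_{n\in F_2}x_n,\dots,\sum_{n\in F_m}x_n): F_1,\dots,F_m \text{ finite nonempty subsets of }\mathbb{N},\ F_1<F_2<\dots<F_m\}\subseteq A$.
   Context: $\beta S$ is the set of ultrafilters on $S$, with $p+q=\{X:\{s:-s+X\in q\}\in p\}$, $-s+X=\{t:s+t\in X\}$; $0_S^*=\{p\in\beta S:(0,\epsilon)\cap S\in p$ for all $\epsilon>0\}$. $F<G$ means $\max F<\min G$. $\otimes_{i=1}^mp$ is the $m$-fold tensor product: $\otimes_{i=1}^1p=p$ and $A\in\otimes_{i=1}^{k+1}p$ iff $\{(x_1,\dots,x_k):\{x_{k+1}:(x_1,\dots,x_{k+1})\in A\}\in p\}\in\otimes_{i=1}^kp$. *)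

theory Defs
  imports "HOL-Analysis.Analysis"
begin

(* An ultrafilter on S is a family of subsets of S (not of the ambient type). *)

definition ultrafilter_on :: "'a set \<Rightarrow> 'a set set \<Rightarrow> bool" where
  "ultrafilter_on S p \<longleftrightarrow>
     p \<subseteq> Pow S \<and> S \<in> p \<and> {} \<notin> p \<and>
     (\<forall>X\<in>p. \<forall>Y\<in>p. X \<inter> Y \<in> p) \<and>
     (\<forall>X\<in>p. \<forall>Y. X \<subseteq> Y \<and> Y \<subseteq> S \<longrightarrow> Y \<in> p) \<and>
     (\<forall>X. X \<subseteq> S \<longrightarrow> X \<in> p \<or> S - X \<in> p)"

definition beta :: "'a set \<Rightarrow> 'a set set set" where
  "beta S = {p. ultrafilter_on S p}"

definition translate_back :: "'a::plus set \<Rightarrow> 'a \<Rightarrow> 'a set \<Rightarrow> 'a set" where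
  "translate_back S s X = {t \<in> S. s + t \<in> X}"

definition beta_plus :: "'a::plus set \<Rightarrow> 'a set set \<Rightarrow> 'a set set \<Rightarrow> 'a set set" where
  "beta_plus S p q = {X. X \<subseteq> S \<and> {s \<in> S. translate_back S s X \<in> q} \<in> p}"

definition zero_star :: "real set \<Rightarrow> real set set set" where
  "zero_star S = {p \<in> beta S. \<forall>\<epsilon>>0. {0<..<\<epsilon>} \<inter> S \<in> p}"

(* S^m is represented by the lists over S of length m. *)

definition tuples :: "'a set \<Rightarrow> nat \<Rightarrow> 'a list set" where
  "tuples S m = {xs. length xs = m \<and> set xs \<subseteq> S}"

(* The 1-fold power is p itself under the identification of S with S^1.
   The 0-fold power is only a convention (the unique ultrafilter on S^0);
   the recursion for the higher powers starts at 1. *)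

fun tensor_power :: "'a set \<Rightarrow> 'a set set \<Rightarrow> nat \<Rightarrow> 'a list set set" where
  "tensor_power S p 0 = {{[]}}"
| "tensor_power S p (Suc 0) = {A. A \<subseteq> tuples S 1 \<and> {x \<in> S. [x] \<in> A} \<in> p}"
| "tensor_power S p (Suc (Suc k)) =
     {A. A \<subseteq> tuples S (Suc (Suc k)) \<and>
         {xs \<in> tuples S (Suc k). {y \<in> S. xs @ [y] \<in> A} \<in> p} \<in> tensor_power S p (Suc k)}"

definition block_less :: "nat set \<Rightarrow> nat set \<Rightarrow> bool" where
  "block_less F G \<longleftrightarrow> Max F < Min G"

(* The list [F_1, ..., F_m] ranges over the increasing chains of m finite nonempty blocks. *)

definition block_sum_tuples :: "(nat \<Rightarrow> 'a::comm_monoid_add) \<Rightarrow> nat \<Rightarrow> 'a list set" where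
  "block_sum_tuples x m =
     {map (\<lambda>F. \<Sum>n\<in>F. x n) Fs | Fs.
        length Fs = m \<and> (\<forall>F\<in>set Fs. finite F \<and> F \<noteq> {}) \<and> successively block_less Fs}"

end

theory Submission
  imports Defs
begin

text \<open>Instead of the Ellis--Numakura lemma for the compact right topological semigroup of
  ultrafilters, idempotents are obtained from filters: a proper filter \<open>F\<close> that is maximal subject to
  \<open>F \<subseteq> F + F\<close> is an idempotent ultrafilter. Starting Zorn's lemma at the filter generated by the
  sets of finite sums of the tails of \<open>x\<close> gives an idempotent \<open>p\<close> that contains all these sets, and the
  block sums of \<open>x\<close> are then found in the tensor power by adding one block at a time. Conversely,
  given \<open>p\<close>, the terms of \<open>x\<close> are chosen one at a time: each new term has to start a new
  block or extend the last one for each of the finitely many block sum tuples formed so far,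
  and idempotency of \<open>p\<close> keeps both possible.\<close>

section \<open>Filters and idempotent ultrafilters\<close>

definition filter_on :: "'a set \<Rightarrow> 'a set set \<Rightarrow> bool" where
  "filter_on S F \<longleftrightarrow>
     F \<subseteq> Pow S \<and> S \<in> F \<and> {} \<notin> F \<and>
     (\<forall>X\<in>F. \<forall>Y\<in>F. X \<inter> Y \<in> F) \<and>
     (\<forall>X\<in>F. \<forall>Y. X \<subseteq> Y \<and> Y \<subseteq> S \<longrightarrow> Y \<in> F)"

lemma ultrafilter_on_iff:
  "ultrafilter_on S p \<longleftrightarrow> filter_on S p \<and> (\<forall>X. X \<subseteq> S \<longrightarrow> X \<in> p \<or> S - X \<in> p)"
  unfolding ultrafilter_on_def filter_on_def by (simp only: conj_assoc)

lemma filter_on_subset: "filter_on S F \<Longrightarrow> X \<in> F \<Longrightarrow> X \<subseteq> S"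
  unfolding filter_on_def by blast

lemma filter_on_mono: "filter_on S F \<Longrightarrow> X \<in> F \<Longrightarrow> X \<subseteq> Y \<Longrightarrow> Y \<subseteq> S \<Longrightarrow> Y \<in> F"
  unfolding filter_on_def by blast

lemma filter_on_Int: "filter_on S F \<Longrightarrow> X \<in> F \<Longrightarrow> Y \<in> F \<Longrightarrow> X \<inter> Y \<in> F"
  unfolding filter_on_def by blast

lemma filter_on_space: "filter_on S F \<Longrightarrow> S \<in> F"
  unfolding filter_on_def by blast

lemma filter_on_not_empty: "filter_on S F \<Longrightarrow> {} \<notin> F"
  unfolding filter_on_def by blast

lemma filter_on_ball:
  assumes F: "filter_on S F" and "finite T" and P: "\<And>t. t \<in> T \<Longrightarrow> {y \<in> S. P t y} \<in> F"
  shows "{y \<in> S. \<forall>t\<in>T. P t y} \<in> F"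
  using assms(2) P
proof (induction T)
  case empty
  then show ?case using filter_on_space[OF F] by simp
next
  case (insert t T)
  have "{y \<in> S. P t y} \<inter> {y \<in> S. \<forall>t\<in>T. P t y} \<in> F"
    using insert by (intro filter_on_Int[OF F]) auto
  moreover have "{y \<in> S. P t y} \<inter> {y \<in> S. \<forall>t\<in>T. P t y} = {y \<in> S. \<forall>t\<in>insert t T. P t y}"
    by auto
  ultimately show ?case by simp
qed

lemma filter_on_Union_chain:
  assumes "\<C> \<noteq> {}" and "subset.chain \<A> \<C>" and "\<And>F. F \<in> \<A> \<Longrightarrow> filter_on S F"
  shows "filter_on S (\<Union>\<C>)"
proof -
  have filt: "filter_on S F" if "F \<in> \<C>" for F
    using assms(2,3) that unfolding subset.chain_def by blast
  have "X \<inter> Y \<in> \<Union>\<C>" if X: "X \<in> \<Union>\<C>" and Y: "Y \<in> \<Union>\<C>" for X Y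
  proof -
    obtain F G where FG: "F \<in> \<C>" "G \<in> \<C>" "X \<in> F" "Y \<in> G"
      using X Y by blast
    then have "F \<subseteq> G \<or> G \<subseteq> F"
      using assms(2) unfolding subset_chain_def by blast
    then show ?thesis
      using FG filter_on_Int[OF filt] by blast
  qed
  moreover have "\<Union>\<C> \<subseteq> Pow S" "{} \<notin> \<Union>\<C>"
    using filt unfolding filter_on_def by blast+
  moreover have "S \<in> \<Union>\<C>"
    using filt assms(1) filter_on_space by blast
  moreover have "\<forall>X\<in>\<Union>\<C>. \<forall>Y. X \<subseteq> Y \<and> Y \<subseteq> S \<longrightarrow> Y \<in> \<Union>\<C>"
    using filter_on_mono[OF filt] by blast
  ultimately show ?thesis
    unfolding filter_on_def by blast
qed

section \<open>Generated filters and the ultrafilter lemma\<close>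

definition filter_join :: "'a set \<Rightarrow> 'a set set \<Rightarrow> 'a set set \<Rightarrow> 'a set set" where
  "filter_join S F B = {X. X \<subseteq> S \<and> (\<exists>Y\<in>F. \<exists>Z\<in>B. Y \<inter> Z \<subseteq> X)}"

text \<open>Closure of \<open>B\<close> under intersections is why one \<open>Z\<close> from
  \<open>B\<close> suffices in \<open>filter_join\<close>; properness is exactly
  \<open>meet\<close>.\<close>

lemma filter_on_filter_join:
  assumes F: "filter_on S F" and "B \<noteq> {}"
    and B: "\<And>X Y. X \<in> B \<Longrightarrow> Y \<in> B \<Longrightarrow> X \<inter> Y \<in> B"
    and meet: "\<And>X Y. X \<in> F \<Longrightarrow> Y \<in> B \<Longrightarrow> X \<inter> Y \<noteq> {}"
  shows "filter_on S (filter_join S F B)"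
proof -
  have "X \<inter> Y \<in> filter_join S F B"
    if X: "X \<in> filter_join S F B" and Y: "Y \<in> filter_join S F B" for X Y
  proof -
    obtain U V U' V' where *: "U \<in> F" "V \<in> B" "U \<inter> V \<subseteq> X" "U' \<in> F" "V' \<in> B" "U' \<inter> V' \<subseteq> Y"
      using X Y unfolding filter_join_def by blast
    then have "U \<inter> U' \<in> F" "V \<inter> V' \<in> B" "(U \<inter> U') \<inter> (V \<inter> V') \<subseteq> X \<inter> Y"
      using filter_on_Int[OF F] B by auto
    then show ?thesis
      using X Y unfolding filter_join_def by blast
  qed
  moreover have "S \<in> filter_join S F B"
    using filter_on_space[OF F] \<open>B \<noteq> {}\<close> unfolding filter_join_def by blast
  moreover have "{} \<notin> filter_join S F B"
    using meet unfolding filter_join_def by auto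
  moreover have "\<forall>X\<in>filter_join S F B. \<forall>Y. X \<subseteq> Y \<and> Y \<subseteq> S \<longrightarrow> Y \<in> filter_join S F B"
    unfolding filter_join_def by blast
  moreover have "filter_join S F B \<subseteq> Pow S"
    unfolding filter_join_def by blast
  ultimately show ?thesis
    unfolding filter_on_def by blast
qed

lemma filter_join_upper1: "filter_on S F \<Longrightarrow> B \<noteq> {} \<Longrightarrow> F \<subseteq> filter_join S F B"
  by (force simp: filter_join_def dest: filter_on_subset)

lemma filter_join_upper2: "filter_on S F \<Longrightarrow> B \<subseteq> Pow S \<Longrightarrow> B \<subseteq> filter_join S F B"
  by (force simp: filter_join_def dest: filter_on_space)

text \<open>A maximal filter decides every \<open>X\<close>: if it contains neither \<open>X\<close>
  nor its complement, each of its members meets \<open>X\<close>, and joining \<open>X\<close> would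
  enlarge it.\<close>

lemma ultrafilter_on_exists:
  assumes "filter_on S F"
  obtains q where "F \<subseteq> q" "ultrafilter_on S q"
proof -
  let ?A = "{G. filter_on S G \<and> F \<subseteq> G}"
  have "\<exists>M\<in>?A. \<forall>G\<in>?A. M \<subseteq> G \<longrightarrow> G = M"
  proof (rule subset_Zorn_nonempty)
    fix \<C> assume C: "\<C> \<noteq> {}" "subset.chain ?A \<C>"
    then show "\<Union>\<C> \<in> ?A"
      using filter_on_Union_chain[OF C, of S] unfolding subset.chain_def by blast
  qed (use assms in blast)
  then obtain M where M: "filter_on S M" "F \<subseteq> M"
    and max: "\<And>G. filter_on S G \<Longrightarrow> M \<subseteq> G \<Longrightarrow> G = M"
    by auto
  have "X \<in> M \<or> S - X \<in> M" if "X \<subseteq> S" for X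
  proof (rule ccontr)
    assume neg: "\<not> ?thesis"
    have meet: "Y \<inter> X \<noteq> {}" if "Y \<in> M" for Y
    proof
      assume "Y \<inter> X = {}"
      then have "Y \<subseteq> S - X"
        using filter_on_subset[OF M(1) that] by blast
      then show False
        using filter_on_mono[OF M(1) that] neg by blast
    qed
    have "filter_on S (filter_join S M {X})"
      using meet by (intro filter_on_filter_join M(1)) auto
    then have "filter_join S M {X} = M"
      using filter_join_upper1[OF M(1)] by (intro max) auto
    then show False
      using filter_join_upper2[OF M(1), of "{X}"] neg that by auto
  qed
  then show ?thesis
    using that M ultrafilter_on_iff by blast
qed

section \<open>Sums of filters\<close>

lemma translate_back_subset: "translate_back S s X \<subseteq> S"
  unfolding translate_back_def by blast

lemma beta_plus_mono: "F \<subseteq> F' \<Longrightarrow> G \<subseteq> G' \<Longrightarrow> filter_on S F' \<Longrightarrow> beta_plus S F G \<subseteq> beta_plus S F' G'"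
proof
  fix X assume sub: "F \<subseteq> F'" "G \<subseteq> G'" and F': "filter_on S F'" and "X \<in> beta_plus S F G"
  then have "{s \<in> S. translate_back S s X \<in> G} \<in> F'" "X \<subseteq> S"
    unfolding beta_plus_def by auto
  moreover have "{s \<in> S. translate_back S s X \<in> G} \<subseteq> {s \<in> S. translate_back S s X \<in> G'}"
    using sub by blast
  ultimately show "X \<in> beta_plus S F' G'"
    using filter_on_mono[OF F'] unfolding beta_plus_def by auto
qed

lemma filter_on_beta_plus:
  assumes F: "filter_on S F" and G: "filter_on S G"
    and closed: "\<And>s t. s \<in> S \<Longrightarrow> t \<in> S \<Longrightarrow> s + t \<in> S"
  shows "filter_on S (beta_plus S F G)"
proof -
  let ?D = "\<lambda>X. {s \<in> S. translate_back S s X \<in> G}"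
  have "X \<inter> Y \<in> beta_plus S F G" if X: "X \<in> beta_plus S F G" and Y: "Y \<in> beta_plus S F G" for X Y
  proof -
    have "translate_back S s (X \<inter> Y) = translate_back S s X \<inter> translate_back S s Y" for s
      unfolding translate_back_def by blast
    then have "?D X \<inter> ?D Y \<subseteq> ?D (X \<inter> Y)"
      using filter_on_Int[OF G] by auto
    moreover have "?D X \<inter> ?D Y \<in> F"
      using X Y unfolding beta_plus_def by (intro filter_on_Int[OF F]) auto
    ultimately have "?D (X \<inter> Y) \<in> F"
      using filter_on_mono[OF F] by blast
    then show ?thesis
      using X Y unfolding beta_plus_def by auto
  qed
  moreover have "Y \<in> beta_plus S F G" if X: "X \<in> beta_plus S F G" and Y: "X \<subseteq> Y" "Y \<subseteq> S" for X Y
  proof -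
    have "translate_back S s X \<subseteq> translate_back S s Y" for s
      using Y unfolding translate_back_def by blast
    then have "?D X \<subseteq> ?D Y"
      using filter_on_mono[OF G] translate_back_subset by (metis (no_types, lifting) Collect_mono)
    moreover have "?D X \<in> F"
      using X unfolding beta_plus_def by auto
    ultimately have "?D Y \<in> F"
      using filter_on_mono[OF F] by blast
    then show ?thesis
      using Y unfolding beta_plus_def by auto
  qed
  moreover have "S \<in> beta_plus S F G"
  proof -
    have "translate_back S s S = S" if "s \<in> S" for s
      using closed that unfolding translate_back_def by blast
    then have "?D S = S"
      using filter_on_space[OF G] by auto
    then show ?thesis
      using filter_on_space[OF F] unfolding beta_plus_def by auto
  qed
  moreover have "{} \<notin> beta_plus S F G"
    using filter_on_not_empty[OF F] filter_on_not_empty[OF G]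
    unfolding beta_plus_def translate_back_def by auto
  moreover have "beta_plus S F G \<subseteq> Pow S"
    unfolding beta_plus_def by blast
  ultimately show ?thesis
    unfolding filter_on_def by blast
qed

section \<open>Idempotents and maximal filters\<close>

context
  fixes S :: "'a::semigroup_add set"
  assumes closed: "\<And>s t. s \<in> S \<Longrightarrow> t \<in> S \<Longrightarrow> s + t \<in> S"
begin

lemma translate_back_translate_back:
  assumes "s \<in> S" "t \<in> S"
  shows "translate_back S t (translate_back S s X) = translate_back S (s + t) X"
  using assms closed unfolding translate_back_def by (auto simp: add.assoc)

text \<open>Translation passes inside the set that defines a sum. This gives associativity for
  arbitrary families and, with \<open>H = q\<close>, the translation rule for \<open>D\<close> in
  the maximality argument below.\<close>

lemma translate_back_Collect:
  assumes "s \<in> S"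
  shows "translate_back S s {u \<in> S. translate_back S u X \<in> H} =
         {t \<in> S. translate_back S t (translate_back S s X) \<in> H}"
proof -
  have "translate_back S s {u \<in> S. translate_back S u X \<in> H} =
        {t \<in> S. translate_back S (s + t) X \<in> H}"
    using assms closed unfolding translate_back_def[of S s "{u \<in> S. translate_back S u X \<in> H}"] by auto
  then show ?thesis
    using translate_back_translate_back[OF assms] by auto
qed

lemma beta_plus_assoc: "beta_plus S (beta_plus S F G) H = beta_plus S F (beta_plus S G H)"
proof -
  have "{s \<in> S. translate_back S s {u \<in> S. translate_back S u X \<in> H} \<in> G} =
        {s \<in> S. {t \<in> S. translate_back S t (translate_back S s X) \<in> H} \<in> G}" for X
    using translate_back_Collect by (intro Collect_cong) auto
  then show ?thesis
    using translate_back_subset[of S] unfolding beta_plus_def by auto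
qed

text \<open>A filter stands for the closed set of ultrafilters above it, and
  \<open>F \<subseteq> beta_plus S F F\<close> makes this set a semigroup, so a maximal
  \<open>F\<close> corresponds to a minimal closed semigroup in the Ellis argument. For an
  ultrafilter \<open>q\<close> above \<open>F\<close>, first F + q = F is shown, then q = F.\<close>

lemma maximal_idempotent_filter:
  assumes F: "filter_on S F" and idem: "F \<subseteq> beta_plus S F F"
    and max: "\<And>G. filter_on S G \<Longrightarrow> F \<subseteq> G \<Longrightarrow> G \<subseteq> beta_plus S G G \<Longrightarrow> G = F"
  shows "ultrafilter_on S F \<and> beta_plus S F F = F"
proof -
  \<comment> \<open>F + q lies above F since F \<subseteq> F + F \<subseteq> F + q. Also F
    \<subseteq> F + F \<subseteq> F + (q + F); adding q on the right gives F + q \<subseteq> (F + q)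
    + (F + q), so maximality applies.\<close>
  have absorb: "beta_plus S F q = F" if q: "filter_on S q" "F \<subseteq> q" for q
  proof (rule max)
    have Fq: "filter_on S (beta_plus S F q)"
      using F q by (auto intro: filter_on_beta_plus closed)
    have "F \<subseteq> beta_plus S q F"
      using idem beta_plus_mono[OF q(2) order.refl q(1), of F] by blast
    then have "beta_plus S F F \<subseteq> beta_plus S F (beta_plus S q F)"
      by (intro beta_plus_mono F) auto
    with idem have "F \<subseteq> beta_plus S (beta_plus S F q) F"
      by (simp add: beta_plus_assoc)
    then have "beta_plus S F q \<subseteq> beta_plus S (beta_plus S (beta_plus S F q) F) q"
      by (intro beta_plus_mono filter_on_beta_plus closed Fq F) auto
    then show "beta_plus S F q \<subseteq> beta_plus S (beta_plus S F q) (beta_plus S F q)"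
      by (simp add: beta_plus_assoc)
    show "F \<subseteq> beta_plus S F q"
      using idem beta_plus_mono[OF order.refl q(2) F] by blast
  qed (use F q closed in \<open>auto intro: filter_on_beta_plus\<close>)
  obtain q where q: "F \<subseteq> q" "ultrafilter_on S q"
    using ultrafilter_on_exists[OF F] .
  then have qf: "filter_on S q" and ultra: "\<And>X. X \<subseteq> S \<Longrightarrow> X \<in> q \<or> S - X \<in> q"
    by (auto simp: ultrafilter_on_iff)
  define D where "D X = {s \<in> S. translate_back S s X \<in> q}" for X
  have D_in_F: "X \<in> F" if "D X \<in> F" "X \<subseteq> S" for X
    using that absorb[OF qf q(1)] unfolding D_def beta_plus_def by blast
  have D_Int: "D X \<inter> D Y = D (X \<inter> Y)" for X Y
  proof -
    have eq: "translate_back S s (X \<inter> Y) = translate_back S s X \<inter> translate_back S s Y" for s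
      unfolding translate_back_def by blast
    have "translate_back S s (X \<inter> Y) \<in> q \<longleftrightarrow> translate_back S s X \<in> q \<and> translate_back S s Y \<in> q" for s
      unfolding eq using filter_on_Int[OF qf] filter_on_mono[OF qf] translate_back_subset
      by (metis inf_le1 inf_le2)
    then show ?thesis
      unfolding D_def by blast
  qed
  text \<open>The filter of the closed semigroup of all \<open>r \<supseteq> F\<close> with \<open>r + q = q\<close>.\<close>
  let ?G = "filter_join S F (D ` q)"
  \<comment> \<open>If \<open>Y\<close> misses \<open>D X\<close>, then
    \<open>Y \<subseteq> D (S - X)\<close> because \<open>q\<close> is ultra. Hence
    \<open>S - X\<close> lies in F + q = F and so in \<open>q\<close>, next to
    \<open>X\<close>.\<close>
  have "Y \<inter> D X \<noteq> {}" if Y: "Y \<in> F" and X: "X \<in> q" for X Y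
  proof
    assume disj: "Y \<inter> D X = {}"
    have "s \<in> D (S - X)" if s: "s \<in> Y" for s
    proof -
      have "s \<in> S"
        using s filter_on_subset[OF F Y] by blast
      moreover have "translate_back S s X \<notin> q"
        using \<open>s \<in> S\<close> s disj unfolding D_def by blast
      then have "S - translate_back S s X \<in> q"
        using ultra[OF translate_back_subset] by blast
      moreover have "S - translate_back S s X = translate_back S s (S - X)"
        using \<open>s \<in> S\<close> closed unfolding translate_back_def by blast
      ultimately show ?thesis
        unfolding D_def by simp
    qed
    then have "D (S - X) \<in> F"
      using filter_on_mono[OF F Y, of "D (S - X)"] unfolding D_def by blast
    then have "S - X \<in> q"
      using D_in_F q(1) by blast
    then have "(S - X) \<inter> X \<in> q"
      using X filter_on_Int[OF qf] by blast
    moreover have "(S - X) \<inter> X = {}"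
      by blast
    ultimately show False
      using filter_on_not_empty[OF qf] by simp
  qed
  then have Gf: "filter_on S ?G"
    using filter_on_space[OF qf] filter_on_Int[OF qf] D_Int
    by (intro filter_on_filter_join F) auto
  have FG: "F \<subseteq> ?G"
    using filter_on_space[OF qf] by (intro filter_join_upper1 F) auto
  have DG: "D ` q \<subseteq> ?G"
    unfolding D_def by (intro filter_join_upper2 F) auto
  have "?G = F"
  proof (rule max[OF Gf FG])
    have GG: "filter_on S (beta_plus S ?G ?G)"
      by (intro filter_on_beta_plus Gf closed)
    have F_GG: "F \<subseteq> beta_plus S ?G ?G"
      using idem beta_plus_mono[OF FG FG Gf] by blast
    have D_GG: "D X \<in> beta_plus S ?G ?G" if X: "X \<in> q" for X
    proof -
      \<comment> \<open>For \<open>s\<close> in \<open>D X\<close> the translate of \<open>X\<close>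
        by \<open>s\<close> is again in \<open>q\<close>, so the translate of \<open>D X\<close> is
        another generator of \<open>?G\<close>.\<close>
      have "D X \<subseteq> {s \<in> S. translate_back S s (D X) \<in> ?G}"
      proof
        fix s assume s: "s \<in> D X"
        then have "s \<in> S" "translate_back S s X \<in> q"
          unfolding D_def by auto
        moreover have "translate_back S s (D X) = D (translate_back S s X)"
          unfolding D_def using \<open>s \<in> S\<close> by (rule translate_back_Collect)
        ultimately show "s \<in> {s \<in> S. translate_back S s (D X) \<in> ?G}"
          using DG by auto
      qed
      moreover have "D X \<in> ?G"
        using DG X by blast
      ultimately have "{s \<in> S. translate_back S s (D X) \<in> ?G} \<in> ?G"
        using filter_on_mono[OF Gf] by (metis (no_types, lifting) mem_Collect_eq subsetI)
      then show ?thesis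
        unfolding beta_plus_def D_def by blast
    qed
    show "?G \<subseteq> beta_plus S ?G ?G"
    proof
      fix X assume "X \<in> ?G"
      then obtain Y Z where "X \<subseteq> S" "Y \<in> F" "Z \<in> q" "Y \<inter> D Z \<subseteq> X"
        unfolding filter_join_def by blast
      moreover have "Y \<inter> D Z \<in> beta_plus S ?G ?G"
        using F_GG D_GG \<open>Y \<in> F\<close> \<open>Z \<in> q\<close> by (intro filter_on_Int[OF GG]) auto
      ultimately show "X \<in> beta_plus S ?G ?G"
        using filter_on_mono[OF GG] by blast
    qed
  qed
  \<comment> \<open>For \<open>X\<close> in \<open>q\<close>, maximality has put \<open>D X\<close>
    into \<open>F\<close>, and F + q = F then puts \<open>X\<close> there.\<close>
  then have "q \<subseteq> F"
    using DG D_in_F filter_on_subset[OF qf] by blast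
  with q absorb[OF F order.refl] show ?thesis
    by (metis subset_antisym)
qed

text \<open>Since sums are monotone, the condition \<open>G \<subseteq> beta_plus S G G\<close>
  survives unions of chains, so Zorn's lemma applies above \<open>F\<close>.\<close>

lemma idempotent_ultrafilter_exists:
  assumes F: "filter_on S F" and idem: "F \<subseteq> beta_plus S F F"
  obtains p where "F \<subseteq> p" "ultrafilter_on S p" "beta_plus S p p = p"
proof -
  let ?A = "{G. filter_on S G \<and> F \<subseteq> G \<and> G \<subseteq> beta_plus S G G}"
  have "\<exists>M\<in>?A. \<forall>G\<in>?A. M \<subseteq> G \<longrightarrow> G = M"
  proof (rule subset_Zorn_nonempty)
    fix \<C> assume C: "\<C> \<noteq> {}" "subset.chain ?A \<C>"
    then have sub: "\<And>G. G \<in> \<C> \<Longrightarrow> G \<in> ?A"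
      unfolding subset.chain_def by blast
    have filt: "filter_on S (\<Union>\<C>)"
      using filter_on_Union_chain[OF C, of S] by blast
    have "G \<subseteq> beta_plus S (\<Union>\<C>) (\<Union>\<C>)" if "G \<in> \<C>" for G
    proof -
      have "beta_plus S G G \<subseteq> beta_plus S (\<Union>\<C>) (\<Union>\<C>)"
        using that by (intro beta_plus_mono filt) auto
      then show ?thesis
        using sub[OF that] by blast
    qed
    then show "\<Union>\<C> \<in> ?A"
      using filt sub C(1) by blast
  qed (use assms in blast)
  then obtain M where M: "filter_on S M" "F \<subseteq> M" "M \<subseteq> beta_plus S M M"
    and max: "\<And>G. filter_on S G \<Longrightarrow> F \<subseteq> G \<Longrightarrow> G \<subseteq> beta_plus S G G \<Longrightarrow> M \<subseteq> G \<Longrightarrow> G = M"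
    by auto
  have "ultrafilter_on S M \<and> beta_plus S M M = M"
    using M max by (intro maximal_idempotent_filter) auto
  then show ?thesis
    using that M(2) by blast
qed

text \<open>Usually written \<open>X\<^sup>\<star>\<close>.\<close>

definition star_set :: "'a set set \<Rightarrow> 'a set \<Rightarrow> 'a set" where
  "star_set p X = {s \<in> X. translate_back S s X \<in> p}"

lemma star_set_in:
  assumes p: "filter_on S p" "beta_plus S p p = p" and X: "X \<in> p"
  shows "star_set p X \<in> p"
proof -
  have "{s \<in> S. translate_back S s X \<in> p} \<in> p"
    using X p(2) unfolding beta_plus_def by blast
  then have "X \<inter> {s \<in> S. translate_back S s X \<in> p} \<in> p"
    using X filter_on_Int[OF p(1)] by blast
  moreover have "X \<inter> {s \<in> S. translate_back S s X \<in> p} = star_set p X"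
    using filter_on_subset[OF p(1) X] unfolding star_set_def by blast
  ultimately show ?thesis by simp
qed

text \<open>The star of a translate is the translate of the star, so \<open>star_set_in\<close>
  applies to the translate of \<open>X\<close>. Thus an element of the star stays in it after adding
  almost any \<open>t\<close>, and this can be repeated: a block can grow indefinitely.\<close>

lemma translate_back_star_set:
  assumes p: "filter_on S p" "beta_plus S p p = p" and X: "X \<subseteq> S" and s: "s \<in> star_set p X"
  shows "translate_back S s (star_set p X) \<in> p"
proof -
  have "s \<in> S" and sX: "translate_back S s X \<in> p"
    using s X unfolding star_set_def by auto
  have "translate_back S s (star_set p X) = star_set p (translate_back S s X)"
    using translate_back_translate_back[OF \<open>s \<in> S\<close>, of _ X]
    unfolding star_set_def by (auto simp: translate_back_def[of S s])
  then show ?thesis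
    using star_set_in[OF p sX] by simp
qed

end

section \<open>Tensor powers as iterated quantifiers\<close>

text \<open>\<open>p_forall S p A k xs\<close> says \<open>xs @ [y\<^sub>1, \<dots>, y\<^sub>k] \<in> A\<close> for \<open>p\<close>-almost all \<open>y\<^sub>1\<close>, then \<open>p\<close>-almost all
  \<open>y\<^sub>2\<close>, and so on.\<close>

fun p_forall :: "'a set \<Rightarrow> 'a set set \<Rightarrow> 'a list set \<Rightarrow> nat \<Rightarrow> 'a list \<Rightarrow> bool" where
  "p_forall S p A 0 xs \<longleftrightarrow> xs \<in> A"
| "p_forall S p A (Suc k) xs \<longleftrightarrow> {y \<in> S. p_forall S p A k (xs @ [y])} \<in> p"

text \<open>\<open>tensor_power\<close> recurses on the last coordinate, the innermost quantifier,
  whereas \<open>p_forall\<close> peels off the outermost one; this lemma reconciles the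
  two.\<close>

lemma p_forall_Suc_right:
  assumes "length xs + k = n" "set xs \<subseteq> S"
  shows "p_forall S p {xs \<in> tuples S n. {y \<in> S. xs @ [y] \<in> A} \<in> p} k xs \<longleftrightarrow> p_forall S p A (Suc k) xs"
  using assms
proof (induction k arbitrary: xs)
  case 0
  then show ?case by (simp add: tuples_def)
next
  case (Suc k)
  have "{y \<in> S. p_forall S p {xs \<in> tuples S n. {y \<in> S. xs @ [y] \<in> A} \<in> p} k (xs @ [y])} =
        {y \<in> S. p_forall S p A (Suc k) (xs @ [y])}"
    using Suc.prems by (intro Collect_cong conj_cong refl Suc.IH) auto
  then show ?case
    unfolding p_forall.simps(2)[of _ _ _ k] p_forall.simps(2)[of _ _ _ "Suc k"] by simp
qed

lemma tensor_power_iff_p_forall: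
  assumes "A \<subseteq> tuples S (Suc n)"
  shows "A \<in> tensor_power S p (Suc n) \<longleftrightarrow> p_forall S p A (Suc n) []"
  using assms
proof (induction n arbitrary: A)
  case 0
  then show ?case by simp
next
  case (Suc n)
  let ?A' = "{xs \<in> tuples S (Suc n). {y \<in> S. xs @ [y] \<in> A} \<in> p}"
  have "A \<in> tensor_power S p (Suc (Suc n)) \<longleftrightarrow> ?A' \<in> tensor_power S p (Suc n)"
    using Suc.prems by simp
  also have "\<dots> \<longleftrightarrow> p_forall S p ?A' (Suc n) []"
    by (rule Suc.IH) auto
  also have "\<dots> \<longleftrightarrow> p_forall S p A (Suc (Suc n)) []"
    by (rule p_forall_Suc_right) auto
  finally show ?case .
qed

section \<open>Block sums\<close>

definition block_chain :: "nat set list \<Rightarrow> bool" where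
  "block_chain Fs \<longleftrightarrow> (\<forall>F\<in>set Fs. finite F \<and> F \<noteq> {}) \<and> successively block_less Fs"

lemma block_chain_snoc:
  "block_chain (Fs @ [F]) \<longleftrightarrow>
     block_chain Fs \<and> finite F \<and> F \<noteq> {} \<and> (Fs \<noteq> [] \<longrightarrow> Max (last Fs) < Min F)"
  unfolding block_chain_def by (auto simp: successively_append_iff block_less_def)

text \<open>\<open>successively\<close> compares neighbours only; the comparisons chain because
  \<open>Min H \<le> Max H\<close> for a nonempty block.\<close>

lemma block_chain_less_Min:
  assumes "block_chain (Fs @ [F])" "G \<in> set Fs" "i \<in> G"
  shows "i < Min F"
  using assms
proof (induction Fs arbitrary: F rule: rev_induct)
  case (snoc H Fs)
  have c: "block_chain (Fs @ [H])" and "Max (last (Fs @ [H])) < Min F"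
    using snoc.prems(1) unfolding block_chain_snoc[of "Fs @ [H]"] by blast+
  then have lt: "Max H < Min F" and "finite H" "H \<noteq> {}"
    unfolding block_chain_snoc by (metis last_snoc, blast+)
  show ?case
  proof (cases "G = H")
    case True
    then show ?thesis using lt snoc.prems(3) \<open>finite H\<close> by (meson Max_ge le_less_trans)
  next
    case False
    then have "i < Min H"
      using snoc.IH[OF c] snoc.prems by auto
    also have "\<dots> \<le> Max H" using \<open>finite H\<close> \<open>H \<noteq> {}\<close> by simp
    finally show ?thesis using lt by simp
  qed
qed simp

lemma sum_in_subsemigroup:
  fixes x :: "'b \<Rightarrow> 'a::comm_monoid_add"
  assumes "finite F" "F \<noteq> {}" "\<And>i. i \<in> F \<Longrightarrow> x i \<in> S"
    and closed: "\<And>s t. s \<in> S \<Longrightarrow> t \<in> S \<Longrightarrow> s + t \<in> S"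
  shows "sum x F \<in> S"
  using assms(1-3) by (induction rule: finite_ne_induct) (auto intro: closed)

section \<open>Finite sums of tails\<close>

definition finite_sums :: "(nat \<Rightarrow> 'a::comm_monoid_add) \<Rightarrow> nat \<Rightarrow> 'a set" where
  "finite_sums x k = {sum x F |F. finite F \<and> F \<noteq> {} \<and> F \<subseteq> {k..}}"

lemma finite_sums_antimono: "k \<le> l \<Longrightarrow> finite_sums x l \<subseteq> finite_sums x k"
  unfolding finite_sums_def by (blast intro: order_trans)

text \<open>The filter generated by the tails satisfies
  \<open>F \<subseteq> beta_plus S F F\<close>: after a sum over \<open>G\<close>, every sum from
  the tail beyond \<open>Max G\<close> can be added without leaving \<open>finite_sums x k\<close>,
  as the index sets are disjoint.\<close>

lemma idempotent_containing_finite_sums: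
  fixes x :: "nat \<Rightarrow> 'a::comm_monoid_add"
  assumes closed: "\<And>s t. s \<in> S \<Longrightarrow> t \<in> S \<Longrightarrow> s + t \<in> S" and x: "\<And>n. x n \<in> S"
  obtains p where "ultrafilter_on S p" "beta_plus S p p = p" "\<And>k. finite_sums x k \<in> p"
proof -
  define F where "F = {X. X \<subseteq> S \<and> (\<exists>k. finite_sums x k \<subseteq> X)}"
  have FS: "finite_sums x k \<subseteq> S" for k
    using closed x unfolding finite_sums_def by (auto intro!: sum_in_subsemigroup)
  have FS_F: "finite_sums x k \<in> F" for k
    using FS unfolding F_def by blast
  have "X \<inter> Y \<in> F" if X: "X \<in> F" and Y: "Y \<in> F" for X Y
  proof -
    obtain k l where "finite_sums x k \<subseteq> X" "finite_sums x l \<subseteq> Y"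
      using X Y unfolding F_def by blast
    then have "finite_sums x (max k l) \<subseteq> X \<inter> Y"
      using finite_sums_antimono[of k "max k l" x] finite_sums_antimono[of l "max k l" x] by auto
    then show ?thesis
      using X Y unfolding F_def by blast
  qed
  moreover have "{} \<notin> F"
  proof -
    have "sum x {k} \<in> finite_sums x k" for k
      unfolding finite_sums_def by blast
    then show ?thesis
      unfolding F_def by blast
  qed
  moreover have "S \<in> F" "F \<subseteq> Pow S"
    using FS unfolding F_def by blast+
  moreover have "\<forall>X\<in>F. \<forall>Y. X \<subseteq> Y \<and> Y \<subseteq> S \<longrightarrow> Y \<in> F"
    unfolding F_def by blast
  ultimately have filt: "filter_on S F"
    unfolding filter_on_def by blast
  have "F \<subseteq> beta_plus S F F"
  proof
    fix X assume "X \<in> F"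
    then obtain k where k: "finite_sums x k \<subseteq> X" and "X \<subseteq> S"
      unfolding F_def by blast
    have "finite_sums x k \<subseteq> {s \<in> S. translate_back S s X \<in> F}"
    proof
      fix s assume s: "s \<in> finite_sums x k"
      then obtain G where G: "s = sum x G" "finite G" "G \<noteq> {}" "G \<subseteq> {k..}"
        unfolding finite_sums_def by blast
      have "finite_sums x (Suc (Max G)) \<subseteq> translate_back S s X"
      proof
        fix t assume t: "t \<in> finite_sums x (Suc (Max G))"
        then obtain H where H: "t = sum x H" "finite H" "H \<noteq> {}" "H \<subseteq> {Suc (Max G)..}"
          unfolding finite_sums_def by blast
        have lt: "g < h" if "g \<in> G" "h \<in> H" for g h
          using Max_ge[OF G(2) that(1)] H(4) that(2) by fastforce
        have "G \<inter> H = {}"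
          using lt by blast
        then have "s + t = sum x (G \<union> H)"
          using G H by (simp add: sum.union_disjoint)
        moreover have "G \<union> H \<subseteq> {k..}"
          using G(3,4) lt by fastforce
        ultimately have "s + t \<in> finite_sums x k"
          using G H unfolding finite_sums_def by blast
        then show "t \<in> translate_back S s X"
          using t k FS unfolding translate_back_def by blast
      qed
      then show "s \<in> {s \<in> S. translate_back S s X \<in> F}"
        using s FS translate_back_subset unfolding F_def by blast
    qed
    then have "{s \<in> S. translate_back S s X \<in> F} \<in> F"
      unfolding F_def by blast
    then show "X \<in> beta_plus S F F"
      using \<open>X \<subseteq> S\<close> unfolding beta_plus_def by blast
  qed
  then obtain p where "F \<subseteq> p" "ultrafilter_on S p" "beta_plus S p p = p"
    using idempotent_ultrafilter_exists[OF closed filt] by blast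
  then show ?thesis
    using that FS_F by blast
qed

text \<open>Whatever blocks have been chosen, the sums over possible next blocks include all finite
  sums of a tail, and these form a member of \<open>p\<close>.\<close>

lemma p_forall_block_sums:
  assumes p: "filter_on S p" and FS: "\<And>k. finite_sums x k \<in> p"
    and A: "block_sum_tuples x m \<subseteq> A"
    and Fs: "block_chain Fs" "length Fs + k = m"
  shows "p_forall S p A k (map (sum x) Fs)"
  using Fs
proof (induction k arbitrary: Fs)
  case 0
  then show ?case
    using A unfolding block_sum_tuples_def block_chain_def by auto
next
  case (Suc k)
  \<comment> \<open>The first index allowed in the next block; the empty chain imposes no
    bound.\<close>
  let ?N = "if Fs = [] then 0 else Suc (Max (last Fs))"
  have "finite_sums x ?N \<subseteq> {y \<in> S. p_forall S p A k (map (sum x) Fs @ [y])}"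
  proof
    fix y assume y: "y \<in> finite_sums x ?N"
    then obtain F where F: "y = sum x F" "finite F" "F \<noteq> {}" "F \<subseteq> {?N..}"
      unfolding finite_sums_def by blast
    have "?N \<le> Min F"
      using F Min_in by blast
    then have "block_chain (Fs @ [F])"
      using F Suc.prems(1) by (auto simp: block_chain_snoc)
    then have "p_forall S p A k (map (sum x) (Fs @ [F]))"
      using Suc.prems(2) by (intro Suc.IH) auto
    then show "y \<in> {y \<in> S. p_forall S p A k (map (sum x) Fs @ [y])}"
      using y filter_on_subset[OF p FS] F(1) by auto
  qed
  then have "{y \<in> S. p_forall S p A k (map (sum x) Fs @ [y])} \<in> p"
    by (rule filter_on_mono[OF p FS]) auto
  then show ?case by simp
qed

text \<open>By positivity a sum over \<open>F\<close> is at most the sum over an interval containing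
  \<open>F\<close>, which the Cauchy criterion bounds. This places the idempotent near zero.\<close>

lemma finite_sums_small:
  fixes x :: "nat \<Rightarrow> real"
  assumes pos: "\<And>n. x n > 0" and "summable x" "\<epsilon> > 0"
  obtains k where "finite_sums x k \<subseteq> {0<..<\<epsilon>}"
proof -
  obtain k where k: "\<And>m n. m \<ge> k \<Longrightarrow> norm (sum x {m..<n}) < \<epsilon>"
    using assms(2,3) unfolding summable_Cauchy by blast
  have "sum x F \<in> {0<..<\<epsilon>}" if F: "finite F" "F \<noteq> {}" "F \<subseteq> {k..}" for F
  proof -
    have "F \<subseteq> {k..<Suc (Max F)}"
      using F by (auto simp: less_Suc_eq_le)
    then have "sum x F \<le> sum x {k..<Suc (Max F)}"
      using pos by (intro sum_mono2) (auto simp: less_imp_le)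
    also have "\<dots> < \<epsilon>"
      using k[of k "Suc (Max F)"] by simp
    finally show ?thesis
      using sum_pos[OF F(1,2), of x] pos by simp
  qed
  then show ?thesis
    using that[of k] unfolding finite_sums_def by blast
qed

section \<open>Sequences from idempotents\<close>

text \<open>The block sum tuples of length at most \<open>m\<close> obtained from those in \<open>T\<close> when \<open>y\<close> becomes available.\<close>

definition extend_tuples :: "nat \<Rightarrow> 'a::plus list set \<Rightarrow> 'a \<Rightarrow> 'a list set" where
  "extend_tuples m T y = T \<union> (\<lambda>xs. xs @ [y]) ` {xs \<in> T. length xs < m} \<union>
     (\<lambda>xs. butlast xs @ [last xs + y]) ` {xs \<in> T. xs \<noteq> []}"

text \<open>The largest new index \<open>n\<close> can occur only in the last block. It is absent,
  forms that block alone, or enlarges it: the three parts of \<open>extend_tuples\<close>.\<close>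

lemma block_sums_in_extend_tuples:
  fixes x :: "nat \<Rightarrow> 'a::comm_monoid_add"
  assumes T0: "[] \<in> T 0" and T: "\<And>n. T (Suc n) = extend_tuples m (T n) (x n)"
    and Fs: "block_chain Fs" "length Fs \<le> m" "\<Union>(set Fs) \<subseteq> {..<n}"
  shows "map (sum x) Fs \<in> T n"
  using Fs
proof (induction n arbitrary: Fs)
  case 0
  then have "Fs = []"
    unfolding block_chain_def by (cases Fs) auto
  then show ?case using T0 by simp
next
  case (Suc n)
  show ?case
  proof (cases "n \<in> \<Union>(set Fs)")
    case False
    then have "\<Union>(set Fs) \<subseteq> {..<n}"
      using Suc.prems(3) False by (auto simp: lessThan_Suc)
    then have "map (sum x) Fs \<in> T n"
      by (intro Suc.IH Suc.prems)
    then show ?thesis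
      unfolding T extend_tuples_def by simp
  next
    case True
    then obtain Gs F where Fs: "Fs = Gs @ [F]"
      by (cases Fs rule: rev_cases) auto
    have F: "block_chain Gs" "finite F" "F \<noteq> {}" "Gs \<noteq> [] \<Longrightarrow> Max (last Gs) < Min F"
      using Suc.prems(1) unfolding Fs block_chain_snoc by auto
    have "Min F < Suc n"
      using Min_in[OF F(2,3)] Suc.prems(3) Fs by auto
    moreover have "i < Min F" if "G \<in> set Gs" "i \<in> G" for G i
      using block_chain_less_Min[OF _ that] Suc.prems(1) Fs by blast
    ultimately have Gs_n: "\<Union>(set Gs) \<subseteq> {..<n}"
      by fastforce
    then have "n \<in> F"
      using True Fs by auto
    show ?thesis
    proof (cases "F = {n}")
      case True
      have "map (sum x) Gs \<in> T n"
        using Suc.prems F Gs_n Fs by (intro Suc.IH) auto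
      then have "map (sum x) Gs @ [x n] \<in> extend_tuples m (T n) (x n)"
        using Suc.prems(2) Fs unfolding extend_tuples_def by auto
      then show ?thesis
        using True Fs T by simp
    next
      case False
      let ?F = "F - {n}"
      have F': "finite ?F" "?F \<noteq> {}"
        using F False \<open>n \<in> F\<close> by auto
      have "Min F \<le> Min ?F"
        \<comment> \<open>Removing \<open>n\<close> from the last block cannot lower its minimum, so
          it still follows the earlier blocks.\<close>
        using F F' by (intro Min_antimono) auto
      then have "block_chain (Gs @ [?F])"
        using F F' unfolding block_chain_snoc by auto
      moreover have "\<Union>(set (Gs @ [?F])) \<subseteq> {..<n}"
        using Gs_n Suc.prems(3) Fs by (auto simp: less_Suc_eq)
      ultimately have "map (sum x) (Gs @ [?F]) \<in> T n"
        using Suc.prems(2) Fs by (intro Suc.IH) auto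
      then have "map (sum x) Gs @ [sum x ?F + x n] \<in> extend_tuples m (T n) (x n)"
        unfolding extend_tuples_def
        by (intro UnI2 rev_image_eqI[of "map (sum x) (Gs @ [?F])"]) simp_all
      moreover have "sum x ?F + x n = sum x F"
        using sum.remove[OF F(2) \<open>n \<in> F\<close>, of x] by (simp add: add.commute)
      ultimately show ?thesis
        using Fs T by simp
    qed
  qed
qed

context
  fixes S :: "'a::comm_monoid_add set" and p :: "'a set set" and m :: nat and A :: "'a list set"
  assumes closed: "\<And>s t. s \<in> S \<Longrightarrow> t \<in> S \<Longrightarrow> s + t \<in> S"
    and p: "filter_on S p" "beta_plus S p p = p"
begin

definition next_set :: "'a list \<Rightarrow> 'a set" where
  "next_set xs = {y \<in> S. p_forall S p A (m - Suc (length xs)) (xs @ [y])}"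

text \<open>The invariant of the construction. The \<open>p_forall\<close> clause allows new blocks
  to follow; the star clause keeps the last block open, since adding almost any \<open>y\<close> to
  its sum stays in the same star.\<close>

definition extendable :: "'a list \<Rightarrow> bool" where
  "extendable xs \<longleftrightarrow> length xs \<le> m \<and> p_forall S p A (m - length xs) xs \<and>
     (xs \<noteq> [] \<longrightarrow> last xs \<in> star_set S p (next_set (butlast xs)))"

lemma next_set_in:
  assumes "extendable xs" "length xs < m"
  shows "next_set xs \<in> p"
proof -
  have "m - length xs = Suc (m - Suc (length xs))"
    using assms(2) by simp
  then show ?thesis
    using assms(1) unfolding extendable_def next_set_def by simp
qed

lemma extendable_snoc:
  assumes "length xs < m" "y \<in> star_set S p (next_set xs)"
  shows "extendable (xs @ [y])"
  using assms unfolding extendable_def by (auto simp: star_set_def[OF closed] next_set_def)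

text \<open>Each tuple imposes two conditions on \<open>y\<close>, for starting a block and for
  enlarging the last one. Both hold on members of \<open>p\<close>, and \<open>T\<close> is
  finite.\<close>

lemma extendable_extend_tuples:
  assumes T: "finite T" "\<forall>xs\<in>T. extendable xs"
  shows "{y \<in> S. \<forall>xs\<in>extend_tuples m T y. extendable xs} \<in> p"
proof -
  let ?P = "\<lambda>xs y. (length xs < m \<longrightarrow> extendable (xs @ [y])) \<and>
                   (xs \<noteq> [] \<longrightarrow> extendable (butlast xs @ [last xs + y]))"
  have "{y \<in> S. ?P xs y} \<in> p" if "xs \<in> T" for xs
  proof -
    have xs: "extendable xs"
      using T that by blast
    have 1: "{y \<in> S. length xs < m \<longrightarrow> extendable (xs @ [y])} \<in> p"
    proof (cases "length xs < m")
      case True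
      have star: "star_set S p (next_set xs) \<in> p"
        using star_set_in[OF closed p next_set_in[OF xs True]] .
      then show ?thesis
        using extendable_snoc[OF True] filter_on_subset[OF p(1) star]
        by (elim filter_on_mono[OF p(1)]) auto
    qed (simp add: filter_on_space[OF p(1)])
    have 2: "{y \<in> S. xs \<noteq> [] \<longrightarrow> extendable (butlast xs @ [last xs + y])} \<in> p"
    proof (cases "xs = []")
      case False
      have "length (butlast xs) < m"
        using False xs unfolding extendable_def by (cases xs) auto
      \<comment> \<open>For \<open>y\<close> in this translate, \<open>last xs + y\<close> is in the
        star of \<open>next_set (butlast xs)\<close>, so it may replace the last entry.\<close>
      moreover have "translate_back S (last xs) (star_set S p (next_set (butlast xs))) \<in> p"
        using False xs unfolding extendable_def
        by (intro translate_back_star_set closed p) (auto simp: next_set_def)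
      ultimately show ?thesis
        using extendable_snoc
        by (elim filter_on_mono[OF p(1)]) (auto simp: translate_back_def)
    qed (simp add: filter_on_space[OF p(1)])
    show ?thesis
      using filter_on_Int[OF p(1) 1 2] by (elim filter_on_mono[OF p(1)]) auto
  qed
  then have "{y \<in> S. \<forall>xs\<in>T. ?P xs y} \<in> p"
    by (intro filter_on_ball p(1) T(1))
  then show ?thesis
    using T(2) by (elim filter_on_mono[OF p(1)]) (auto simp: extend_tuples_def)
qed

text \<open>The sets \<open>U n\<close> carry side conditions on the terms, later their size. Each
  meets the set of admissible \<open>y\<close>, as both lie in \<open>p\<close>.\<close>

lemma block_sum_sequence_exists:
  assumes A: "p_forall S p A m []" and U: "\<And>n::nat. U n \<in> p"
  obtains x :: "nat \<Rightarrow> 'a" where "\<And>n. x n \<in> U n" "block_sum_tuples x m \<subseteq> A"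
proof -
  have "\<exists>y\<in>U n. \<forall>xs\<in>extend_tuples m T y. extendable xs"
    if "finite T" "\<forall>xs\<in>T. extendable xs" for T n
  proof -
    have "U n \<inter> {y \<in> S. \<forall>xs\<in>extend_tuples m T y. extendable xs} \<in> p"
      using extendable_extend_tuples[OF that] by (intro filter_on_Int[OF p(1)] U)
    then have "U n \<inter> {y \<in> S. \<forall>xs\<in>extend_tuples m T y. extendable xs} \<noteq> {}"
      using filter_on_not_empty[OF p(1)] by metis
    then show ?thesis by blast
  qed
  \<comment> \<open>Choosing for every \<open>T\<close> and \<open>n\<close> at once lets
    \<open>T\<close> be defined by plain recursion, with \<open>x\<close> read off
    afterwards.\<close>
  then obtain f where f: "\<And>T n. finite T \<Longrightarrow> \<forall>xs\<in>T. extendable xs \<Longrightarrow>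
      f T n \<in> U n \<and> (\<forall>xs\<in>extend_tuples m T (f T n). extendable xs)"
    by metis
  define T where "T = rec_nat {[]} (\<lambda>n T. extend_tuples m T (f T n))"
  define x where "x n = f (T n) n" for n
  have T0: "T 0 = {[]}" and T_Suc: "T (Suc n) = extend_tuples m (T n) (x n)" for n
    unfolding T_def x_def by simp_all
  have inv: "finite (T n) \<and> (\<forall>xs\<in>T n. extendable xs)" for n
  proof (induction n)
    case 0
    then show ?case using A unfolding T0 extendable_def by simp
  next
    case (Suc n)
    moreover have "finite (T (Suc n))"
      using Suc unfolding T_Suc extend_tuples_def by simp
    ultimately show ?case
      using f[of "T n" n] unfolding T_Suc x_def by blast
  qed
  have "x n \<in> U n" for n
    using f inv unfolding x_def by blast
  moreover have "block_sum_tuples x m \<subseteq> A"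
  proof
    fix xs assume "xs \<in> block_sum_tuples x m"
    then obtain Fs where xs: "xs = map (sum x) Fs" and Fs: "length Fs = m" "block_chain Fs"
      unfolding block_sum_tuples_def block_chain_def by auto
    have "finite (\<Union>(set Fs))"
      using Fs(2) unfolding block_chain_def by auto
    then obtain n where "\<Union>(set Fs) \<subseteq> {..<n}"
      using finite_nat_iff_bounded by blast
    then have "xs \<in> T n"
      unfolding xs using Fs T0 T_Suc by (intro block_sums_in_extend_tuples[of T m]) auto
    \<comment> \<open>At length \<open>m\<close> no quantifier is left in \<open>p_forall\<close>,
      so extendability contains membership in \<open>A\<close>.\<close>
    then have "extendable xs" "length xs = m"
      using inv xs Fs by auto
    then show "xs \<in> A"
      unfolding extendable_def by simp
  qed
  ultimately show ?thesis
    using that by blast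
qed

end

section \<open>Idempotents near zero and convergent series\<close>

theorem theorem4p13:
  fixes m :: nat and S :: "real set" and A :: "real list set"
  assumes "m \<ge> 1"
    and "S \<subseteq> {0<..}"
    and "\<And>s t. s \<in> S \<Longrightarrow> t \<in> S \<Longrightarrow> s + t \<in> S"
    and "{0..} \<subseteq> closure S"
    and "A \<subseteq> tuples S m"
  shows "(\<exists>p \<in> zero_star S. beta_plus S p p = p \<and> A \<in> tensor_power S p m) \<longleftrightarrow>
         (\<exists>x :: nat \<Rightarrow> real. (\<forall>n. x n \<in> S) \<and> summable x \<and> block_sum_tuples x m \<subseteq> A)"
proof -
  note closed = assms(3)
  have tensor: "A \<in> tensor_power S p m \<longleftrightarrow> p_forall S p A m []" for p
    using tensor_power_iff_p_forall[of A S "m - 1" p] assms(1,5) by simp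
  show ?thesis
  proof
    assume "\<exists>p \<in> zero_star S. beta_plus S p p = p \<and> A \<in> tensor_power S p m"
    then obtain p where p: "filter_on S p" "beta_plus S p p = p" "p_forall S p A m []"
      and small: "\<And>\<epsilon>. \<epsilon> > 0 \<Longrightarrow> {0<..<\<epsilon>} \<inter> S \<in> p"
      unfolding zero_star_def beta_def ultrafilter_on_iff tensor by blast
    \<comment> \<open>The bounds make the geometric series dominate \<open>x\<close>.\<close>
    have "{0<..<(1/2)^n} \<inter> S \<in> p" for n :: nat
      by (rule small) simp
    then obtain x where x: "\<And>n. x n \<in> {0<..<(1/2)^n} \<inter> S" and A: "block_sum_tuples x m \<subseteq> A"
      using block_sum_sequence_exists[OF closed p, of "\<lambda>n. {0<..<(1/2)^n} \<inter> S"] by blast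
    have "norm (x n) \<le> (1/2)^n" for n
      using x[of n] by auto
    then have "summable x"
      by (intro summable_comparison_test'[of "\<lambda>n. (1/2)^n" 0 x] summable_geometric) auto
    then show "\<exists>x. (\<forall>n. x n \<in> S) \<and> summable x \<and> block_sum_tuples x m \<subseteq> A"
      using x A by blast
  next
    assume "\<exists>x. (\<forall>n. x n \<in> S) \<and> summable x \<and> block_sum_tuples x m \<subseteq> A"
    then obtain x where x: "\<And>n. x n \<in> S" "summable x" and A: "block_sum_tuples x m \<subseteq> A"
      by blast
    obtain p where p: "ultrafilter_on S p" "beta_plus S p p = p" and FS: "\<And>k. finite_sums x k \<in> p"
      using idempotent_containing_finite_sums[of S x, OF closed x(1)] by blast
    have filt: "filter_on S p"
      using p(1) by (simp add: ultrafilter_on_iff)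
    have "{0<..<\<epsilon>} \<inter> S \<in> p" if eps: "\<epsilon> > 0" for \<epsilon>
    proof -
      have "\<And>n. x n > 0"
        using x(1) assms(2) by auto
      then obtain k where "finite_sums x k \<subseteq> {0<..<\<epsilon>}"
        using finite_sums_small[of x \<epsilon>] x(2) eps by blast
      then show ?thesis
        using filter_on_mono[OF filt FS] filter_on_subset[OF filt FS] by (meson Int_lower2 le_inf_iff)
    qed
    then have "p \<in> zero_star S"
      using p(1) unfolding zero_star_def beta_def by blast
    moreover have "p_forall S p A m []"
      using p_forall_block_sums[of S p x m A "[]" m, OF filt FS A] by (simp add: block_chain_def)
    ultimately show "\<exists>p \<in> zero_star S. beta_plus S p p = p \<and> A \<in> tensor_power S p m"
      using p(2) tensor by blast
  qed
qed

end
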